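(* Let $n\ge m\ge 1$ be integers. Then $$r(n,m) > r(n,-m)\ \text{ if } n\equiv m \pmod 2,\qquad r(n,-m) > r(n,m)\ \text{ if } n\not\equiv m \pmod 2.$$
   Context: A partition is a finite, nonempty, nonincreasing sequence of positive integers called its parts. The perimeter of a partition $\pi$ is $\alpha_\pi+\lambda_\pi-1$, where $\alpha_\pi$ is the largest part of $\pi$ and $\lambda_\pi$ is the number of parts of $\pi$ (counted with multiplicity). For a partition $\pi$, let $o(\pi)$ and $e(\pi)$ be the numbers of odd and even parts of $\pi$ (counted with multiplicity), and $\omega(\pi)=o(\pi)-e(\pi)$. For an integer $m$, $r(n,m)$ is the number of partitions $\pi$ of perimeter $n$ with $\omega(\pi)=m$. *)

theory Defs
  imports Main "HOL-Number_Theory.Cong"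
begin

definition is_partition :: "nat list \<Rightarrow> bool" where
  "is_partition p \<longleftrightarrow> p \<noteq> [] \<and> sorted_wrt (\<ge>) p \<and> (\<forall>x\<in>set p. x > 0)"

definition largest_part :: "nat list \<Rightarrow> nat" where
  "largest_part p = Max (set p)"

definition perimeter :: "nat list \<Rightarrow> int" where
  "perimeter p = int (largest_part p) + int (length p) - 1"

definition num_odd_parts :: "nat list \<Rightarrow> nat" where
  "num_odd_parts p = length (filter odd p)"

definition num_even_parts :: "nat list \<Rightarrow> nat" where
  "num_even_parts p = length (filter even p)"

definition omega :: "nat list \<Rightarrow> int" where
  "omega p = int (num_odd_parts p) - int (num_even_parts p)"

definition r :: "int \<Rightarrow> int \<Rightarrow> nat" where
  "r n m = card {p. is_partition p \<and> perimeter p = n \<and> omega p = m}"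

text \<open>The set counted by \<^const>\<open>r\<close> is finite, so its \<^const>\<open>card\<close> is the true count.\<close>

lemma finite_partitions_perimeter:
  "finite {p. is_partition p \<and> perimeter p = n \<and> omega p = m}"
proof (rule finite_subset)
  show "{p. is_partition p \<and> perimeter p = n \<and> omega p = m}
      \<subseteq> {p. set p \<subseteq> {..nat n} \<and> length p \<le> nat n + 1}"
  proof (intro subsetI CollectI conjI)
    fix p x
    assume p: "p \<in> {p. is_partition p \<and> perimeter p = n \<and> omega p = m}"
    then have ne: "length p \<ge> 1" and per: "int (Max (set p)) + int (length p) - 1 = n"
      by (auto simp: is_partition_def perimeter_def largest_part_def Suc_le_eq)
    then show "length p \<le> nat n + 1"
      by linarith
    assume "x \<in> set p"
    then have "x \<le> Max (set p)"
      by simp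
    with ne per show "x \<in> {..nat n}"
      by simp
  qed
  show "finite {p. set p \<subseteq> {..nat n} \<and> length p \<le> nat n + 1}"
    by (rule finite_lists_length_le) simp
qed

end

theory Submission
  imports Defs
begin

text \<open>
  Every partition of perimeter at least two arises in exactly one way from a partition of
  perimeter one less: either a part \<open>1\<close> was appended, which raises \<^const>\<open>omega\<close> by one, or
  every part was increased by one, which swaps odd and even parts and negates \<^const>\<open>omega\<close>.
  Hence \<open>r n m = r (n - 1) (m - 1) + r (n - 1) (- m)\<close> for \<open>n \<ge> 2\<close> (\<open>r_rec\<close>).

  Let \<open>F\<^sub>n(z) = \<Sum>\<^sub>m r n m \<cdot> z\<^sup>m\<close>. The recurrence takes the pair \<open>F\<^sub>n(z), F\<^sub>n(1/z)\<close> to the pair for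
  \<open>n + 1\<close> by the matrix with rows \<open>(z, 1)\<close> and \<open>(1, 1/z)\<close>, which has determinant \<open>0\<close> and trace
  \<open>z + 1/z\<close>. By Cayley-Hamilton its square is the trace times itself, so from perimeter
  two on, passing to the next perimeter is multiplication by \<open>z + 1/z\<close>:
  \<open>r n m = r (n - 1) (m - 1) + r (n - 1) (m + 1)\<close> for \<open>n \<ge> 3\<close> (\<open>r_rec_symmetric\<close>).

  The antisymmetric difference \<open>r_diff n m = r n m - r n (- m)\<close> satisfies the same recurrence.
  It changes both \<open>n\<close> and \<open>m\<close> by one, so the parity of \<open>n - m\<close> is the same in all terms. The
  signs predicted by the theorem therefore reinforce each other (\<open>r_diff_sign\<close>), and induction
  on \<open>n\<close> propagates them from \<open>n = 2\<close>, where \<open>r_diff 2 2 = 1\<close> and \<open>r_diff 2 1 = - 1\<close>. For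
  \<open>m = 1\<close> the recurrence reaches out of the range \<open>m \<ge> 1\<close>, but only to \<open>r_diff (n - 1) 0 = 0\<close>.
\<close>

section \<open>Building partitions by increasing the perimeter\<close>

lemma le_largest_part: "x \<in> set p \<Longrightarrow> x \<le> largest_part p"
  by (simp add: largest_part_def)

lemma partition_ne: "is_partition p \<Longrightarrow> p \<noteq> []"
  by (simp add: is_partition_def)

lemma partition_pos: "is_partition p \<Longrightarrow> x \<in> set p \<Longrightarrow> x \<ge> 1"
  by (simp add: is_partition_def Suc_le_eq)

lemma largest_part_pos: "is_partition p \<Longrightarrow> largest_part p \<ge> 1"
  by (metis partition_ne partition_pos le_largest_part hd_in_set le_trans)

lemma partition_append_one:
  "q \<noteq> [] \<Longrightarrow> is_partition (q @ [1]) \<longleftrightarrow> is_partition q"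
  by (auto simp: is_partition_def sorted_wrt_append Suc_le_eq)

lemma perimeter_append_one:
  assumes "is_partition q"
  shows "perimeter (q @ [1]) = perimeter q + 1"
proof -
  have "largest_part (q @ [1]) = max 1 (largest_part q)"
    using partition_ne[OF assms] by (simp add: largest_part_def)
  then show ?thesis
    using largest_part_pos[OF assms] by (simp add: perimeter_def max_def)
qed

lemma omega_append_one: "omega (q @ [1]) = omega q + 1"
  by (simp add: omega_def num_odd_parts_def num_even_parts_def)

lemma partition_map_Suc: "is_partition q \<Longrightarrow> is_partition (map Suc q)"
  by (auto simp: is_partition_def sorted_wrt_map)

lemma perimeter_map_Suc: "q \<noteq> [] \<Longrightarrow> perimeter (map Suc q) = perimeter q + 1"
  by (simp add: perimeter_def largest_part_def mono_Max_commute[symmetric] mono_Suc)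

lemma omega_map_Suc: "omega (map Suc q) = - omega q"
  by (simp add: omega_def num_odd_parts_def num_even_parts_def filter_map comp_def)

lemma partition_with_one_cases:
  assumes "is_partition p" "1 \<in> set p"
  obtains q where "p = q @ [1]"
proof -
  have p: "p = butlast p @ [last p]"
    using partition_ne[OF assms(1)] by simp
  have "sorted_wrt (\<ge>) (butlast p @ [last p])"
    using assms(1) p by (simp add: is_partition_def)
  then have "\<forall>x\<in>set (butlast p). last p \<le> x"
    by (simp add: sorted_wrt_append)
  moreover have "1 \<in> set (butlast p) \<or> last p = 1"
    using assms(2) p by (metis Un_iff set_append empty_iff insert_iff list.set(1,2))
  moreover have "last p \<ge> 1"
    using partition_pos[OF assms(1)] partition_ne[OF assms(1)] by simp
  ultimately have "last p = 1"
    using le_antisym by blast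
  then show thesis
    using p that by metis
qed

lemma partition_without_one_cases:
  assumes "is_partition p" "1 \<notin> set p"
  obtains q where "is_partition q" "p = map Suc q"
proof
  have ge2: "x \<ge> 2" if "x \<in> set p" for x
    using partition_pos[OF assms(1) that] assms(2) that by (cases "x = 1") auto
  show "p = map Suc (map (\<lambda>x. x - 1) p)"
    using ge2 by (fastforce intro!: map_idI[symmetric] simp: comp_def)
  have "sorted_wrt (\<lambda>x y. y - 1 \<le> x - 1) p"
    using assms(1) by (auto simp: is_partition_def intro: sorted_wrt_mono_rel[rotated])
  then show "is_partition (map (\<lambda>x. x - 1) p)"
    using assms(1) ge2 by (fastforce simp: is_partition_def sorted_wrt_map)
qed

section \<open>Recurrences for the counts\<close>

definition partitions_with :: "int \<Rightarrow> int \<Rightarrow> nat list set" where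
  "partitions_with n m = {p. is_partition p \<and> perimeter p = n \<and> omega p = m}"

lemma r_eq_card: "r n m = card (partitions_with n m)"
  by (simp add: r_def partitions_with_def)

lemma finite_partitions_with: "finite (partitions_with n m)"
  unfolding partitions_with_def by (rule finite_partitions_perimeter)

text \<open>
  The bound \<open>n \<ge> 2\<close> excludes the partition \<open>[1]\<close>, whose only part cannot be removed.
\<close>

lemma partitions_with_decompose:
  assumes "n \<ge> 2"
  shows "partitions_with n m =
    (\<lambda>q. q @ [1]) ` partitions_with (n - 1) (m - 1) \<union> map Suc ` partitions_with (n - 1) (- m)"
    (is "?L = ?A \<union> ?B")
proof
  have "q @ [1] \<in> ?L" if "q \<in> partitions_with (n - 1) (m - 1)" for q
    using that partition_append_one[of q] perimeter_append_one[of q] omega_append_one[of q]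
      partition_ne[of q]
    by (simp add: partitions_with_def)
  moreover have "map Suc q \<in> ?L" if "q \<in> partitions_with (n - 1) (- m)" for q
    using that partition_map_Suc[of q] perimeter_map_Suc[of q] omega_map_Suc[of q]
      partition_ne[of q]
    by (simp add: partitions_with_def)
  ultimately show "?A \<union> ?B \<subseteq> ?L"
    by blast
  show "?L \<subseteq> ?A \<union> ?B"
  proof
    fix p assume p: "p \<in> ?L"
    then have part: "is_partition p" and per: "perimeter p = n" and om: "omega p = m"
      by (simp_all add: partitions_with_def)
    show "p \<in> ?A \<union> ?B"
    proof (cases "1 \<in> set p")
      case True
      then obtain q where q: "p = q @ [1]"
        using partition_with_one_cases[OF part] by metis
      have "q \<noteq> []"
        using per assms q by (auto simp: perimeter_def largest_part_def)
      then have "is_partition q"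
        using part q partition_append_one by metis
      then have "q \<in> partitions_with (n - 1) (m - 1)"
        using per om q perimeter_append_one[of q] omega_append_one[of q]
        by (simp add: partitions_with_def)
      then show ?thesis
        using q by blast
    next
      case False
      then obtain q where q: "is_partition q" "p = map Suc q"
        using partition_without_one_cases[OF part] by metis
      then have "q \<in> partitions_with (n - 1) (- m)"
        using per om perimeter_map_Suc[of q] omega_map_Suc[of q] partition_ne
        by (simp add: partitions_with_def)
      then show ?thesis
        using q by blast
    qed
  qed
qed

lemma r_rec:
  assumes "n \<ge> 2"
  shows "r n m = r (n - 1) (m - 1) + r (n - 1) (- m)"
proof -
  let ?A = "(\<lambda>q. q @ [1]) ` partitions_with (n - 1) (m - 1)"
  let ?B = "map Suc ` partitions_with (n - 1) (- m)"
  \<comment> \<open>Only the partitions in the first set contain the part \<open>1\<close>.\<close>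
  have "?A \<inter> ?B = {}"
  proof -
    have "1 \<in> set p" if "p \<in> ?A" for p
      using that by auto
    moreover have "1 \<notin> set p" if "p \<in> ?B" for p
      using that partition_pos by (fastforce simp: partitions_with_def)
    ultimately show ?thesis
      by blast
  qed
  then have "card (?A \<union> ?B) = card ?A + card ?B"
    by (intro card_Un_disjoint finite_imageI finite_partitions_with)
  moreover have "card ?A = r (n - 1) (m - 1)"
    unfolding r_eq_card by (intro card_image inj_onI) simp
  moreover have "card ?B = r (n - 1) (- m)"
    unfolding r_eq_card by (intro card_image inj_onI) (simp add: inj_map_eq_map)
  ultimately show ?thesis
    using partitions_with_decompose[OF assms] r_eq_card by metis
qed

text \<open>
  Expanding \<open>r (n - 1) (- m)\<close> and \<open>r (n - 1) (m + 1)\<close> once more by \<open>r_rec\<close> gives the same two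
  summands. For generating functions this is the step from determinant \<open>0\<close> to multiplication by
  the trace.
\<close>

lemma r_rec_symmetric:
  assumes "n \<ge> 3"
  shows "r n m = r (n - 1) (m - 1) + r (n - 1) (m + 1)"
proof -
  have "r (n - 1) (- m) = r (n - 2) (- m - 1) + r (n - 2) m"
    using r_rec[of "n - 1" "- m"] assms by simp
  moreover have "r (n - 1) (m + 1) = r (n - 2) m + r (n - 2) (- m - 1)"
    using r_rec[of "n - 1" "m + 1"] assms by simp
  ultimately show ?thesis
    using r_rec[of n m] assms by simp
qed

lemma r_one: "r 1 m = (if m = 1 then 1 else 0)"
proof -
  have "p = [1]" if "is_partition p" "perimeter p = 1" for p
  proof -
    have "length p \<ge> 1"
      using partition_ne[OF that(1)] by (simp add: Suc_le_eq)
    then have "length p = 1" "largest_part p = 1"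
      using that(2) largest_part_pos[OF that(1)] by (auto simp: perimeter_def)
    then show ?thesis
      by (cases p) (auto simp: largest_part_def)
  qed
  moreover have "is_partition [1]" "perimeter [1] = 1" "omega [1] = 1"
    by (simp_all add: is_partition_def perimeter_def largest_part_def omega_def
        num_odd_parts_def num_even_parts_def)
  ultimately have "p \<in> partitions_with 1 m \<longleftrightarrow> p = [1] \<and> m = 1" for p
    unfolding partitions_with_def by blast
  then have "partitions_with 1 m = (if m = 1 then {[1]} else {})"
    by (simp add: set_eq_iff)
  then show ?thesis
    by (simp add: r_eq_card)
qed

section \<open>The sign of the antisymmetric difference\<close>

definition r_diff :: "int \<Rightarrow> int \<Rightarrow> int" where
  "r_diff n m = int (r n m) - int (r n (- m))"

lemma r_diff_rec:
  assumes "n \<ge> 3"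
  shows "r_diff n m = r_diff (n - 1) (m - 1) + r_diff (n - 1) (m + 1)"
  using r_rec_symmetric[OF assms, of m] r_rec_symmetric[OF assms, of "- m"]
  by (simp add: r_diff_def)

lemma r_diff_zero: "r_diff n 0 = 0"
  by (simp add: r_diff_def)

lemma r_diff_two: "m \<ge> 1 \<Longrightarrow> r_diff 2 m = (if m = 1 then - 1 else if m = 2 then 1 else 0)"
  using r_rec[of 2 m] r_rec[of 2 "- m"] by (auto simp: r_diff_def r_one)

text \<open>
  The weak inequality, claimed also for \<open>m > n\<close>, makes the induction close: in the step for
  \<open>m \<le> n\<close> the summand at \<open>m + 1\<close> may lie beyond the range of strict positivity. The summand at
  \<open>m - 1\<close> is strictly positive unless \<open>m = 1\<close>, when it vanishes and the one at \<open>m + 1 = 2\<close> is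
  strictly positive because the previous perimeter is at least two.
\<close>

lemma r_diff_sign:
  assumes "n \<ge> 2" "m \<ge> 1"
  defines "s \<equiv> \<lambda>k::int. if even k then 1 else - 1 :: int"
  shows "s (n - m) * r_diff n m \<ge> 0 \<and> (m \<le> n \<longrightarrow> s (n - m) * r_diff n m > 0)"
  using assms(1,2)
proof (induction n arbitrary: m rule: int_ge_induct)
  case base
  then show ?case
    by (auto simp: r_diff_two s_def)
next
  case (step n)
  have s: "s (n - (m - 1)) = s (n + 1 - m)" "s (n - (m + 1)) = s (n + 1 - m)"
    by (simp_all add: s_def)
  have rec: "s (n + 1 - m) * r_diff (n + 1) m
      = s (n + 1 - m) * r_diff n (m - 1) + s (n + 1 - m) * r_diff n (m + 1)"
    using r_diff_rec[of "n + 1" m] step.hyps by (simp add: distrib_left)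
  have upper: "s (n + 1 - m) * r_diff n (m + 1) \<ge> 0"
    "m + 1 \<le> n \<longrightarrow> s (n + 1 - m) * r_diff n (m + 1) > 0"
    using step.IH[of "m + 1"] step.prems unfolding s by auto
  show ?case
  proof (cases "m = 1")
    case True
    then have "s (n + 1 - m) * r_diff n (m - 1) = 0"
      by (simp add: r_diff_zero)
    then show ?thesis
      using rec upper True step.hyps by linarith
  next
    case False
    then have "s (n + 1 - m) * r_diff n (m - 1) \<ge> 0"
      "m - 1 \<le> n \<longrightarrow> s (n + 1 - m) * r_diff n (m - 1) > 0"
      using step.IH[of "m - 1"] step.prems unfolding s by auto
    then show ?thesis
      using rec upper(1) by linarith
  qed
qed

theorem theorem1p3:
  fixes n m :: int
  assumes "n \<ge> m" and "m \<ge> 1"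
  shows "([n = m] (mod 2) \<longrightarrow> r n m > r n (- m)) \<and>
         (\<not> [n = m] (mod 2) \<longrightarrow> r n (- m) > r n m)"
proof -
  have parity: "[n = m] (mod 2) \<longleftrightarrow> even (n - m)"
    by (simp add: cong_iff_dvd_diff)
  show ?thesis
  proof (cases "n = 1")
    case True
    then show ?thesis
      using assms by (simp add: r_one)
  next
    case False
    then have "(if even (n - m) then 1 else - 1) * r_diff n m > 0"
      using r_diff_sign[of n m] assms by linarith
    then show ?thesis
      unfolding parity by (auto simp: r_diff_def split: if_splits)
  qed
qed

end
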